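(* The logic $\mathbf{Grz}$ enjoys the uniform Lyndon interpolation property. Moreover, for any formula $\varphi$ and any finite sets $P,Q$ of propositional variables there exists a uniform Lyndon interpolant $\theta$ of $(\varphi,P,Q)$ in $\mathbf{Grz}$ with $d(\theta)\le 3n(\varphi)+3$.
   Context: Formulas are built from countably many propositional variables, $\bot$, $\to$ and $\Box$ (other connectives are abbreviations). Modal depth: $d(p)=d(\bot)=0$, $d(\varphi\to\psi)=\max\{d(\varphi),d(\psi)\}$, $d(\Box\varphi)=d(\varphi)+1$. Positive/negative variable sets: $v^+(p)=\{p\}$, $v^-(p)=\emptyset$; $v^\pm(\bot)=\emptyset$; $v^+(\psi\to\theta)=v^-(\psi)\cup v^+(\theta)$, $v^-(\psi\to\theta)=v^+(\psi)\cup v^-(\theta)$; $v^\pm(\Box\psi)=v^\pm(\psi)$. $\mathrm{Sub}(\varphi)$ is the set of subformulas of $\varphi$ and $n(\varphi)=|\{\psi:\Box\psi\in\mathrm{Sub}(\varphi)\}|$. A normal logic is a set of formulas containing all tautologies and $\Box(p\to q)\to(\Box p\to\Box q)$, closed under modus ponens, necessitation and uniform substitution; $L\vdash\varphi$ means $\varphi\in L$. $\mathbf{Grz}$ is the least normal logic containing $\Box(\Box(p\to\Box p)\to p)\to p$. For a normal logic $L$, formula $\varphi$ and finite sets $P,Q$ of variables, a uniform Lyndon interpolant of $(\varphi,P,Q)$ in $L$ is a formula $\theta$ with $v^+(\theta)\subseteq v^+(\varphi)\setminus P$, $v^-(\theta)\subseteq v^-(\varphi)\setminus Q$, $L\vdash\varphi\to\theta$,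 and such that $L\vdash\theta\to\psi$ for every $\psi$ with $v^+(\psi)\cap P=v^-(\psi)\cap Q=\emptyset$ and $L\vdash\varphi\to\psi$. $L$ enjoys the uniform Lyndon interpolation property if such an interpolant exists for all $\varphi,P,Q$. *)

theory Defs
  imports Main
begin

datatype fm =
    Var nat
  | Bot  ("\<^bold>\<bottom>")
  | Imp fm fm  (infixr "\<^bold>\<rightarrow>" 55)
  | Box fm  ("\<^bold>\<box> _" [70] 70)

primrec mdepth :: "fm \<Rightarrow> nat" where
  "mdepth (Var p) = 0"
| "mdepth \<^bold>\<bottom> = 0"
| "mdepth (A \<^bold>\<rightarrow> B) = max (mdepth A) (mdepth B)"
| "mdepth (\<^bold>\<box> A) = mdepth A + 1"

fun vpos :: "fm \<Rightarrow> nat set" and vneg :: "fm \<Rightarrow> nat set" where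
  "vpos (Var p) = {p}"
| "vpos \<^bold>\<bottom> = {}"
| "vpos (A \<^bold>\<rightarrow> B) = vneg A \<union> vpos B"
| "vpos (\<^bold>\<box> A) = vpos A"
| "vneg (Var p) = {}"
| "vneg \<^bold>\<bottom> = {}"
| "vneg (A \<^bold>\<rightarrow> B) = vpos A \<union> vneg B"
| "vneg (\<^bold>\<box> A) = vneg A"

primrec Sub :: "fm \<Rightarrow> fm set" where
  "Sub (Var p) = {Var p}"
| "Sub \<^bold>\<bottom> = {\<^bold>\<bottom>}"
| "Sub (A \<^bold>\<rightarrow> B) = {A \<^bold>\<rightarrow> B} \<union> Sub A \<union> Sub B"
| "Sub (\<^bold>\<box> A) = {\<^bold>\<box> A} \<union> Sub A"

definition nbox :: "fm \<Rightarrow> nat" where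
  "nbox A = card {B. \<^bold>\<box> B \<in> Sub A}"

lemma finite_Sub: "finite (Sub A)"
  by (induction A) auto

lemma finite_boxed_Sub: "finite {B. \<^bold>\<box> B \<in> Sub A}"
  using finite_vimageI[OF finite_Sub, of Box A] by (auto simp: inj_def vimage_def)

primrec subst :: "(nat \<Rightarrow> fm) \<Rightarrow> fm \<Rightarrow> fm" where
  "subst s (Var p) = s p"
| "subst s \<^bold>\<bottom> = \<^bold>\<bottom>"
| "subst s (A \<^bold>\<rightarrow> B) = subst s A \<^bold>\<rightarrow> subst s B"
| "subst s (\<^bold>\<box> A) = \<^bold>\<box> (subst s A)"

text \<open>Classical propositional evaluation: variables and boxed formulas are both treated as
  atoms, the first argument interpreting the former and the second the latter.\<close>

primrec peval :: "(nat \<Rightarrow> bool) \<Rightarrow> (fm \<Rightarrow> bool) \<Rightarrow> fm \<Rightarrow> bool" where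
  "peval v w (Var p) = v p"
| "peval v w \<^bold>\<bottom> = False"
| "peval v w (A \<^bold>\<rightarrow> B) = (peval v w A \<longrightarrow> peval v w B)"
| "peval v w (\<^bold>\<box> A) = w A"

definition tautology :: "fm \<Rightarrow> bool" where
  "tautology A \<longleftrightarrow> (\<forall>v w. peval v w A)"

definition normal_logic :: "fm set \<Rightarrow> bool" where
  "normal_logic L \<longleftrightarrow>
     (\<forall>A. tautology A \<longrightarrow> A \<in> L) \<and>
     \<^bold>\<box> (Var 0 \<^bold>\<rightarrow> Var 1) \<^bold>\<rightarrow> (\<^bold>\<box> (Var 0) \<^bold>\<rightarrow> \<^bold>\<box> (Var 1)) \<in> L \<and>
     (\<forall>A B. A \<in> L \<longrightarrow> A \<^bold>\<rightarrow> B \<in> L \<longrightarrow> B \<in> L) \<and>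
     (\<forall>A. A \<in> L \<longrightarrow> \<^bold>\<box> A \<in> L) \<and>
     (\<forall>A s. A \<in> L \<longrightarrow> subst s A \<in> L)"

definition Grz_axiom :: fm where
  "Grz_axiom = \<^bold>\<box> (\<^bold>\<box> (Var 0 \<^bold>\<rightarrow> \<^bold>\<box> (Var 0)) \<^bold>\<rightarrow> Var 0) \<^bold>\<rightarrow> Var 0"

definition Grz :: "fm set" where
  "Grz = \<Inter> {L. normal_logic L \<and> Grz_axiom \<in> L}"

lemma normal_logic_Grz: "normal_logic Grz"
  unfolding Grz_def normal_logic_def by blast

lemma Grz_axiom_in_Grz: "Grz_axiom \<in> Grz"
  by (simp add: Grz_def)

lemma Grz_least: "normal_logic L \<Longrightarrow> Grz_axiom \<in> L \<Longrightarrow> Grz \<subseteq> L"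
  by (auto simp: Grz_def)

definition uniform_Lyndon_interpolant ::
    "fm set \<Rightarrow> fm \<Rightarrow> nat set \<Rightarrow> nat set \<Rightarrow> fm \<Rightarrow> bool" where
  "uniform_Lyndon_interpolant L A P Q C \<longleftrightarrow>
     vpos C \<subseteq> vpos A - P \<and>
     vneg C \<subseteq> vneg A - Q \<and>
     A \<^bold>\<rightarrow> C \<in> L \<and>
     (\<forall>B. vpos B \<inter> P = {} \<longrightarrow> vneg B \<inter> Q = {} \<longrightarrow> A \<^bold>\<rightarrow> B \<in> L \<longrightarrow> C \<^bold>\<rightarrow> B \<in> L)"

definition uniform_Lyndon_interpolation :: "fm set \<Rightarrow> bool" where
  "uniform_Lyndon_interpolation L \<longleftrightarrow>
     (\<forall>A P Q. finite P \<longrightarrow> finite Q \<longrightarrow> (\<exists>C. uniform_Lyndon_interpolant L A P Q C))"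

end

theory Submission
  imports Defs
begin

text \<open>Grz is the logic of finite partial orders. Let \<open>N = 3 n(A) + 1\<close>. There are finitely many
  formulas of depth at most \<open>N\<close> up to equivalence, and the interpolant \<open>C\<close> is the conjunction of
  those consequences of \<open>A\<close> among them that satisfy the polarity constraints. If \<open>C \<rightarrow> B\<close> fails at
  a point \<open>y\<close>, then by the choice of \<open>C\<close> some point \<open>x\<close> satisfies \<open>A\<close> and every such formula true
  at \<open>x\<close> is true at \<open>y\<close>. This \<open>N\<close>-layered directed simulation is unfolded into a finite partial
  order of pairs \<open>(x', y')\<close> whose first components decide the subformulas of \<open>A\<close> and whose second
  components decide \<open>B\<close>. It has enough layers, because three layers suffice between two
  changes in the set of those \<open>\<box>D \<in> Sub A\<close> that hold at the first component, and this
  set can grow at most \<open>n(A)\<close> times.\<close>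

section \<open>Kripke semantics over finite partial orders\<close>

primrec sat :: "'w set \<Rightarrow> ('w \<Rightarrow> 'w \<Rightarrow> bool) \<Rightarrow> ('w \<Rightarrow> nat \<Rightarrow> bool) \<Rightarrow> 'w \<Rightarrow> fm \<Rightarrow> bool" where
  "sat W R V w (Var p) = V w p"
| "sat W R V w \<^bold>\<bottom> = False"
| "sat W R V w (A \<^bold>\<rightarrow> B) = (sat W R V w A \<longrightarrow> sat W R V w B)"
| "sat W R V w (\<^bold>\<box> A) = (\<forall>u\<in>W. R w u \<longrightarrow> sat W R V u A)"

locale finite_poset =
  fixes W :: "'w set" and R :: "'w \<Rightarrow> 'w \<Rightarrow> bool"
  assumes finite_worlds: "finite W"
    and refl: "x \<in> W \<Longrightarrow> R x x"
    and trans: "x \<in> W \<Longrightarrow> y \<in> W \<Longrightarrow> z \<in> W \<Longrightarrow> R x y \<Longrightarrow> R y z \<Longrightarrow> R x z"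
    and antisym: "x \<in> W \<Longrightarrow> y \<in> W \<Longrightarrow> R x y \<Longrightarrow> R y x \<Longrightarrow> x = y"
begin

text \<open>If \<open>x\<close> is not yet maximal, another point with \<open>P\<close> lies above
  it, and by antisymmetry that point has a strictly smaller up-set; induction on the size of the
  up-set ends the climb.\<close>

lemma maximal_above:
  assumes "x \<in> W" "P x"
  obtains u where "u \<in> W" "R x u" "P u" "\<And>v. v \<in> W \<Longrightarrow> R u v \<Longrightarrow> P v \<Longrightarrow> v = u"
proof -
  have "\<exists>u\<in>W. R x u \<and> P u \<and> (\<forall>v\<in>W. R u v \<longrightarrow> P v \<longrightarrow> v = u)"
    using assms
  proof (induction "card {v \<in> W. R x v}" arbitrary: x rule: less_induct)
    case less
    show ?case
    proof (cases "\<forall>v\<in>W. R x v \<longrightarrow> P v \<longrightarrow> v = x")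
      case True
      then show ?thesis using less.prems refl by blast
    next
      case False
      then obtain v where v: "v \<in> W" "R x v" "P v" "v \<noteq> x" by blast
      have "{z \<in> W. R v z} \<subset> {z \<in> W. R x z}"
      proof
        show "{z \<in> W. R v z} \<subseteq> {z \<in> W. R x z}" using v less.prems trans by blast
        show "{z \<in> W. R v z} \<noteq> {z \<in> W. R x z}" using v less.prems refl antisym by blast
      qed
      then have "card {z \<in> W. R v z} < card {z \<in> W. R x z}"
        using finite_worlds by (intro psubset_card_mono) auto
      from less.hyps[OF this v(1,3)] show ?thesis using v less.prems trans by blast
    qed
  qed
  then show ?thesis using that by blast
qed

lemma sat_box_mono:
  "x \<in> W \<Longrightarrow> y \<in> W \<Longrightarrow> R x y \<Longrightarrow> sat W R V x (\<^bold>\<box> A) \<Longrightarrow> sat W R V y (\<^bold>\<box> A)"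
  by simp (blast intro: trans)

end

lemma sat_subst:
  "sat W R V w (subst s A) = sat W R (\<lambda>w p. sat W R V w (s p)) w A"
  by (induction A arbitrary: w) auto

lemma sat_peval:
  "sat W R V w A = peval (V w) (\<lambda>B. sat W R V w (\<^bold>\<box> B)) A"
  by (induction A) auto

text \<open>The formulas valid on the frame under all valuations form a normal logic; varying
  \<open>V\<close> is what gives closure under substitution.\<close>

lemma (in finite_poset) Grz_sound:
  assumes "A \<in> Grz" "w \<in> W"
  shows "sat W R V w A"
proof -
  let ?L = "{A. \<forall>V. \<forall>w\<in>W. sat W R V w A}"
  have "normal_logic ?L"
    unfolding normal_logic_def
  proof (intro conjI allI impI)
    fix A assume "tautology A"
    then show "A \<in> ?L" by (simp add: tautology_def sat_peval[of _ _ _ _ A])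
  next
    fix A s assume "A \<in> ?L"
    then show "subst s A \<in> ?L" by (simp add: sat_subst)
  qed auto
  moreover have "Grz_axiom \<in> ?L"
  proof (clarsimp simp: Grz_axiom_def)
    fix V w
    assume w: "w \<in> W"
      and hyp: "\<forall>u\<in>W. R w u \<longrightarrow>
        (\<forall>v\<in>W. R u v \<longrightarrow> V v 0 \<longrightarrow> (\<forall>z\<in>W. R v z \<longrightarrow> V z 0)) \<longrightarrow> V u (0::nat)"
    show "V w 0"
    proof (rule ccontr)
      assume "\<not> V w 0"
      \<comment> \<open>At a maximal refuting \<open>u\<close>, the hypothesis yields
        \<open>v\<close> above \<open>u\<close> satisfying the variable and a refuting
        \<open>z\<close> above \<open>v\<close>. Maximality gives \<open>z = u\<close>, antisymmetry
        gives \<open>v = u\<close>, a contradiction.\<close>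
      then obtain u where u: "u \<in> W" "R w u" "\<not> V u 0"
        and mx: "\<And>v. v \<in> W \<Longrightarrow> R u v \<Longrightarrow> \<not> V v 0 \<Longrightarrow> v = u"
        using maximal_above[of w "\<lambda>u. \<not> V u 0"] w by blast
      with hyp obtain v z where "v \<in> W" "R u v" "V v 0" "z \<in> W" "R v z" "\<not> V z 0" by blast
      then show False using u mx trans antisym by metis
    qed
  qed
  ultimately show ?thesis using Grz_least assms by blast
qed

section \<open>Derivations in Grz\<close>

lemma Grz_taut: "tautology A \<Longrightarrow> A \<in> Grz"
  using normal_logic_Grz unfolding normal_logic_def by blast

lemma Grz_mp: "A \<^bold>\<rightarrow> B \<in> Grz \<Longrightarrow> A \<in> Grz \<Longrightarrow> B \<in> Grz"
  using normal_logic_Grz unfolding normal_logic_def by blast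

lemma Grz_nec: "A \<in> Grz \<Longrightarrow> \<^bold>\<box> A \<in> Grz"
  using normal_logic_Grz unfolding normal_logic_def by blast

lemma Grz_subst: "A \<in> Grz \<Longrightarrow> subst s A \<in> Grz"
  using normal_logic_Grz unfolding normal_logic_def by blast

lemma Grz_K: "\<^bold>\<box> (A \<^bold>\<rightarrow> B) \<^bold>\<rightarrow> (\<^bold>\<box> A \<^bold>\<rightarrow> \<^bold>\<box> B) \<in> Grz"
proof -
  have "\<^bold>\<box> (Var 0 \<^bold>\<rightarrow> Var 1) \<^bold>\<rightarrow> (\<^bold>\<box> (Var 0) \<^bold>\<rightarrow> \<^bold>\<box> (Var 1)) \<in> Grz"
    using normal_logic_Grz unfolding normal_logic_def by blast
  from Grz_subst[OF this, of "\<lambda>p. if p = 0 then A else B"] show ?thesis by simp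
qed

lemma Grz_instance: "\<^bold>\<box> (\<^bold>\<box> (A \<^bold>\<rightarrow> \<^bold>\<box> A) \<^bold>\<rightarrow> A) \<^bold>\<rightarrow> A \<in> Grz"
  using Grz_subst[OF Grz_axiom_in_Grz, of "\<lambda>p. A"] by (simp add: Grz_axiom_def)

lemma Grz_conseq1: "A \<in> Grz \<Longrightarrow> (\<And>v w. peval v w A \<Longrightarrow> peval v w B) \<Longrightarrow> B \<in> Grz"
  by (rule Grz_mp[of A], rule Grz_taut) (auto simp: tautology_def)

lemma Grz_conseq2:
  "A \<in> Grz \<Longrightarrow> B \<in> Grz \<Longrightarrow> (\<And>v w. peval v w A \<Longrightarrow> peval v w B \<Longrightarrow> peval v w C) \<Longrightarrow> C \<in> Grz"
  by (rule Grz_mp[of B], rule Grz_conseq1[of A]) auto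

lemma Grz_conseq3:
  "A \<in> Grz \<Longrightarrow> B \<in> Grz \<Longrightarrow> C \<in> Grz \<Longrightarrow>
    (\<And>v w. peval v w A \<Longrightarrow> peval v w B \<Longrightarrow> peval v w C \<Longrightarrow> peval v w D) \<Longrightarrow> D \<in> Grz"
  by (rule Grz_mp[of C], rule Grz_conseq2[of A B]) auto

lemma Grz_box_mono: "A \<^bold>\<rightarrow> B \<in> Grz \<Longrightarrow> \<^bold>\<box> A \<^bold>\<rightarrow> \<^bold>\<box> B \<in> Grz"
  by (rule Grz_mp[OF Grz_K Grz_nec])

lemma Grz_T: "\<^bold>\<box> A \<^bold>\<rightarrow> A \<in> Grz"
proof -
  have "\<^bold>\<box> A \<^bold>\<rightarrow> \<^bold>\<box> (\<^bold>\<box> (A \<^bold>\<rightarrow> \<^bold>\<box> A) \<^bold>\<rightarrow> A) \<in> Grz"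
    by (rule Grz_box_mono, rule Grz_taut) (simp add: tautology_def)
  then show ?thesis by (rule Grz_conseq2[OF _ Grz_instance]) auto
qed

lemma Grz_4: "\<^bold>\<box> A \<^bold>\<rightarrow> \<^bold>\<box> (\<^bold>\<box> A) \<in> Grz"
proof -
  \<comment> \<open>\<open>E\<close> is \<open>A \<and> (\<box>A \<rightarrow> \<box>\<box>A)\<close>. Given \<open>A\<close>, both \<open>\<box>E\<close> and \<open>\<not>E\<close> imply \<open>\<box>A\<close>,
    so the Grz axiom for \<open>E\<close> applies under the hypothesis \<open>\<box>A\<close>.\<close>
  define E where "E = (A \<^bold>\<rightarrow> (\<^bold>\<box> A \<^bold>\<rightarrow> \<^bold>\<box> (\<^bold>\<box> A)) \<^bold>\<rightarrow> \<^bold>\<bottom>) \<^bold>\<rightarrow> \<^bold>\<bottom>"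
  have "\<^bold>\<box> E \<^bold>\<rightarrow> \<^bold>\<box> A \<in> Grz"
    by (rule Grz_box_mono, rule Grz_taut) (simp add: tautology_def E_def)
  then have "(E \<^bold>\<rightarrow> \<^bold>\<box> E) \<^bold>\<rightarrow> (A \<^bold>\<rightarrow> \<^bold>\<box> A) \<in> Grz"
    by (rule Grz_conseq1) (auto simp: E_def)
  then have "\<^bold>\<box> (E \<^bold>\<rightarrow> \<^bold>\<box> E) \<^bold>\<rightarrow> \<^bold>\<box> (A \<^bold>\<rightarrow> \<^bold>\<box> A) \<in> Grz" by (rule Grz_box_mono)
  then have "A \<^bold>\<rightarrow> (\<^bold>\<box> (E \<^bold>\<rightarrow> \<^bold>\<box> E) \<^bold>\<rightarrow> E) \<in> Grz"
    by (rule Grz_conseq2[OF _ Grz_K[of A "\<^bold>\<box> A"]]) (auto simp: E_def)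
  then have "\<^bold>\<box> A \<^bold>\<rightarrow> \<^bold>\<box> (\<^bold>\<box> (E \<^bold>\<rightarrow> \<^bold>\<box> E) \<^bold>\<rightarrow> E) \<in> Grz" by (rule Grz_box_mono)
  then show ?thesis
    by (rule Grz_conseq2[OF _ Grz_instance[of E]]) (auto simp: E_def)
qed

section \<open>Consequence from hypotheses\<close>

definition imps :: "fm list \<Rightarrow> fm \<Rightarrow> fm" where
  "imps As A = foldr Imp As A"

lemma imps_simps [simp]: "imps [] A = A" "imps (B # As) A = B \<^bold>\<rightarrow> imps As A"
  by (simp_all add: imps_def)

lemma peval_imps [simp]: "peval v w (imps As A) \<longleftrightarrow> ((\<forall>B\<in>set As. peval v w B) \<longrightarrow> peval v w A)"
  by (induction As) auto

text \<open>Local consequence: necessitation is applied to theorems only, which keeps the deduction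
  theorem valid.\<close>

definition derives :: "fm set \<Rightarrow> fm \<Rightarrow> bool" where
  "derives G A \<longleftrightarrow> (\<exists>As. set As \<subseteq> G \<and> imps As A \<in> Grz)"

lemma derives_Grz: "A \<in> Grz \<Longrightarrow> derives G A"
  unfolding derives_def by (intro exI[of _ "[]"]) simp

lemma derives_empty: "derives {} A \<longleftrightarrow> A \<in> Grz"
  unfolding derives_def by auto

lemma derives_assm: "A \<in> G \<Longrightarrow> derives G A"
  unfolding derives_def
  by (intro exI[of _ "[A]"]) (auto intro!: Grz_taut simp: tautology_def)

lemma derives_mono: "derives G A \<Longrightarrow> G \<subseteq> H \<Longrightarrow> derives H A"
  unfolding derives_def by blast

lemma derives_mp: "derives G (A \<^bold>\<rightarrow> B) \<Longrightarrow> derives G A \<Longrightarrow> derives G B"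
  unfolding derives_def
proof (elim exE conjE)
  fix As Bs
  assume "set As \<subseteq> G" "imps As (A \<^bold>\<rightarrow> B) \<in> Grz" "set Bs \<subseteq> G" "imps Bs A \<in> Grz"
  then show "\<exists>Cs. set Cs \<subseteq> G \<and> imps Cs B \<in> Grz"
    by (intro exI[of _ "As @ Bs"] conjI, simp)
      (rule Grz_conseq2[of "imps As (A \<^bold>\<rightarrow> B)" "imps Bs A"], auto)
qed

lemma derives_ded: "derives (insert A G) B \<Longrightarrow> derives G (A \<^bold>\<rightarrow> B)"
  unfolding derives_def
proof (elim exE conjE)
  fix As
  assume "set As \<subseteq> insert A G" "imps As B \<in> Grz"
  then show "\<exists>Cs. set Cs \<subseteq> G \<and> imps Cs (A \<^bold>\<rightarrow> B) \<in> Grz"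
    by (intro exI[of _ "filter (\<lambda>C. C \<noteq> A) As"] conjI, force) (rule Grz_conseq1, auto)
qed

lemma derives_taut: "tautology A \<Longrightarrow> derives G A"
  by (rule derives_Grz[OF Grz_taut])

text \<open>Each boxed hypothesis is moved to the right and distributed by \<open>Grz_K\<close>;
  \<open>Grz_4\<close> supplies the doubly boxed premise that this creates.\<close>

lemma imps_boxed_nec:
  assumes "set As \<subseteq> range Box" "imps As A \<in> Grz"
  shows "imps As (\<^bold>\<box> A) \<in> Grz"
  using assms
proof (induction As arbitrary: A)
  case Nil
  then show ?case by (simp add: Grz_nec)
next
  case (Cons B As)
  from Cons.prems(1) obtain C where B: "B = \<^bold>\<box> C" by auto
  have "imps As (B \<^bold>\<rightarrow> A) \<in> Grz" by (rule Grz_conseq1[OF Cons.prems(2)]) auto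
  with Cons have "imps As (\<^bold>\<box> (B \<^bold>\<rightarrow> A)) \<in> Grz" by auto
  then show ?case
    by (rule Grz_conseq3[OF _ Grz_K[of B A] Grz_4[of C]]) (auto simp: B)
qed

lemma derives_boxed_nec:
  assumes "G \<subseteq> range Box" "derives G A"
  shows "derives G (\<^bold>\<box> A)"
  using assms imps_boxed_nec unfolding derives_def by (meson order_trans)

section \<open>Completeness for finite partial orders\<close>

abbreviation Neg :: "fm \<Rightarrow> fm" where
  "Neg A \<equiv> A \<^bold>\<rightarrow> \<^bold>\<bottom>"

text \<open>The members of \<open>X\<close> are decided one at a time: if adding \<open>B\<close> is
  inconsistent, its negation is already derivable and can be added instead.\<close>

lemma Lindenbaum_finite:
  assumes "finite X" "\<not> derives G \<^bold>\<bottom>"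
  shows "\<exists>w\<subseteq>X. \<not> derives (G \<union> w \<union> Neg ` (X - w)) \<^bold>\<bottom>"
  using assms
proof (induction X rule: finite_induct)
  case empty
  then show ?case by simp
next
  case (insert B X)
  then obtain w where w: "w \<subseteq> X" "\<not> derives (G \<union> w \<union> Neg ` (X - w)) \<^bold>\<bottom>" by blast
  let ?H = "G \<union> w \<union> Neg ` (X - w)"
  show ?case
  proof (cases "derives (insert B ?H) \<^bold>\<bottom>")
    case False
    moreover have "G \<union> insert B w \<union> Neg ` (insert B X - insert B w) \<subseteq> insert B ?H" by auto
    ultimately have "\<not> derives (G \<union> insert B w \<union> Neg ` (insert B X - insert B w)) \<^bold>\<bottom>"
      using derives_mono by blast
    then show ?thesis using w(1) by (intro exI[of _ "insert B w"]) auto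
  next
    case True
    then have "derives ?H (Neg B)" by (rule derives_ded)
    then have "\<not> derives (insert (Neg B) ?H) \<^bold>\<bottom>"
      using w(2) derives_ded derives_mp by blast
    moreover have "G \<union> w \<union> Neg ` (insert B X - w) \<subseteq> insert (Neg B) ?H" by auto
    ultimately have "\<not> derives (G \<union> w \<union> Neg ` (insert B X - w)) \<^bold>\<bottom>"
      using derives_mono by blast
    then show ?thesis using w(1) by blast
  qed
qed

lemma finite_Grz_boxes: "finite {\<^bold>\<box> (D \<^bold>\<rightarrow> \<^bold>\<box> D) | D. \<^bold>\<box> D \<in> Sub A}"
proof -
  have "{\<^bold>\<box> (D \<^bold>\<rightarrow> \<^bold>\<box> D) | D. \<^bold>\<box> D \<in> Sub A} = (\<lambda>D. \<^bold>\<box> (D \<^bold>\<rightarrow> \<^bold>\<box> D)) ` {D. \<^bold>\<box> D \<in> Sub A}"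
    by auto
  then show ?thesis using finite_boxed_Sub by simp
qed

lemma Sub_refl: "A \<in> Sub A"
  by (cases A) auto

lemma Sub_trans: "B \<in> Sub A \<Longrightarrow> C \<in> Sub B \<Longrightarrow> C \<in> Sub A"
  by (induction A) auto

lemma Sub_ImpD: "B \<^bold>\<rightarrow> C \<in> Sub A \<Longrightarrow> B \<in> Sub A \<and> C \<in> Sub A"
  using Sub_trans[of "B \<^bold>\<rightarrow> C" A] Sub_refl by auto

lemma Sub_BoxD: "\<^bold>\<box> B \<in> Sub A \<Longrightarrow> B \<in> Sub A"
  using Sub_trans[of "\<^bold>\<box> B" A] Sub_refl by auto

text \<open>A finite canonical model whose worlds are the consistent ways of deciding
  \<open>X\<close>. The Grz axiom provides refuting successors that contain strictly more
  boxes.\<close>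

theorem Grz_complete:
  assumes "A \<notin> Grz"
  obtains W :: "fm set set" and R V w
    where "finite_poset W R" "w \<in> W" "\<not> sat W R V w A"
proof -
  \<comment> \<open>The extra boxes mark progress: a proper successor refuting \<open>D\<close> will
    be told apart from \<open>w\<close> by containing
    \<open>\<box>(D \<rightarrow> \<box>D)\<close>.\<close>
  define X where "X = Sub A \<union> {\<^bold>\<box> (D \<^bold>\<rightarrow> \<^bold>\<box> D) | D. \<^bold>\<box> D \<in> Sub A}"
  define W where "W = {w. w \<subseteq> X \<and> \<not> derives (w \<union> Neg ` (X - w)) \<^bold>\<bottom>}"
  \<comment> \<open>This is a partial order by construction; the price is that every refuting
    successor other than \<open>w\<close> must gain a box.\<close>
  define R where "R w u \<longleftrightarrow> w = u \<or> {B. \<^bold>\<box> B \<in> w} \<subset> {B. \<^bold>\<box> B \<in> u}" for w u :: "fm set"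
  define V where "V w p \<longleftrightarrow> Var p \<in> w" for w :: "fm set" and p
  have finX: "finite X" unfolding X_def using finite_Sub finite_Grz_boxes by blast
  have "finite W" by (rule finite_subset[of _ "Pow X"]) (auto simp: W_def finX)
  then have poset: "finite_poset W R"
    by unfold_locales (auto simp: R_def)
  have closed: "C \<in> w" if "w \<in> W" "derives w C" "C \<in> X" for w C
  proof (rule ccontr)
    assume "C \<notin> w"
    then have "derives (w \<union> Neg ` (X - w)) (Neg C)" using that by (intro derives_assm) auto
    moreover have "derives (w \<union> Neg ` (X - w)) C" using that(2) derives_mono by blast
    ultimately show False using that(1) derives_mp unfolding W_def by blast
  qed
  have extend: "\<exists>w\<in>W. G \<inter> X \<subseteq> w \<and> (\<forall>C\<in>X. Neg C \<in> G \<longrightarrow> C \<notin> w)" if "\<not> derives G \<^bold>\<bottom>" for G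
  proof -
    from Lindenbaum_finite[OF finX that] obtain w
      where w: "w \<subseteq> X" "\<not> derives (G \<union> w \<union> Neg ` (X - w)) \<^bold>\<bottom>" by blast
    have no_clash: "Neg C \<notin> G \<union> w \<union> Neg ` (X - w)" if "C \<in> G \<union> w \<union> Neg ` (X - w)" for C
      using w(2) derives_mp[OF derives_assm derives_assm[OF that]] by meson
    have "w \<union> Neg ` (X - w) \<subseteq> G \<union> w \<union> Neg ` (X - w)" by (simp add: Un_assoc)
    then have "w \<in> W" using w derives_mono unfolding W_def by (metis (mono_tags, lifting) mem_Collect_eq)
    moreover have "C \<in> w" if "C \<in> G \<inter> X" for C using no_clash[of C] that by auto
    moreover have "C \<notin> w" if "Neg C \<in> G" for C using no_clash[of C] that by auto
    ultimately show ?thesis by blast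
  qed
  have bot: "\<^bold>\<bottom> \<notin> w" if "w \<in> W" for w
    using that derives_assm unfolding W_def by blast
  have truth: "sat W R V w C \<longleftrightarrow> C \<in> w" if "C \<in> Sub A" "w \<in> W" for C w
    using that
  proof (induction C arbitrary: w)
    case (Var p)
    then show ?case by (simp add: V_def)
  next
    case Bot
    then show ?case using bot by simp
  next
    case (Imp C D)
    note sub = Sub_ImpD[OF Imp.prems(1)]
    then have X: "C \<in> X" "D \<in> X" "C \<^bold>\<rightarrow> D \<in> X" using Imp.prems(1) by (auto simp: X_def)
    have "D \<in> w" if "C \<^bold>\<rightarrow> D \<in> w" "C \<in> w"
      using closed[OF Imp.prems(2) _ X(2)] that derives_mp derives_assm by blast
    moreover have "C \<^bold>\<rightarrow> D \<in> w" if "D \<in> w"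
    proof (rule closed[OF Imp.prems(2) _ X(3)])
      show "derives w (C \<^bold>\<rightarrow> D)"
        by (rule derives_mp[OF derives_taut derives_assm[OF that]]) (simp add: tautology_def)
    qed
    moreover have "C \<^bold>\<rightarrow> D \<in> w" if "C \<notin> w"
    proof (rule ccontr)
      assume neg: "C \<^bold>\<rightarrow> D \<notin> w"
      let ?H = "w \<union> Neg ` (X - w)"
      have 1: "derives ?H (Neg C)" "derives ?H (Neg (C \<^bold>\<rightarrow> D))"
        using that neg X by (auto intro!: derives_assm)
      have "derives ?H (Neg C \<^bold>\<rightarrow> Neg (C \<^bold>\<rightarrow> D) \<^bold>\<rightarrow> \<^bold>\<bottom>)"
        by (rule derives_taut) (simp add: tautology_def)
      then have "derives ?H \<^bold>\<bottom>" using 1 derives_mp by blast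
      then show False using Imp.prems(2) by (simp add: W_def)
    qed
    ultimately show ?case using Imp sub by auto
  next
    case (Box D)
    note sub = Sub_BoxD[OF Box.prems(1)]
    then have X: "D \<in> X" "\<^bold>\<box> D \<in> X" "\<^bold>\<box> (D \<^bold>\<rightarrow> \<^bold>\<box> D) \<in> X"
      using Box.prems(1) by (auto simp: X_def)
    show ?case
    proof
      assume boxD: "\<^bold>\<box> D \<in> w"
      have "D \<in> u" if "u \<in> W" "R w u" for u
      proof (rule closed[OF that(1) _ X(1)])
        have "\<^bold>\<box> D \<in> u" using boxD that(2) by (auto simp: R_def)
        then show "derives u D" by (rule derives_mp[OF derives_Grz[OF Grz_T] derives_assm])
      qed
      then show "sat W R V w (\<^bold>\<box> D)" using Box.IH sub by simp
    next
      assume sat: "sat W R V w (\<^bold>\<box> D)"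
      show "\<^bold>\<box> D \<in> w"
      proof (rule ccontr)
        assume nbox: "\<^bold>\<box> D \<notin> w"
        have "R w w" by (simp add: R_def)
        \<comment> \<open>By reflexivity \<open>D\<close> is in \<open>w\<close>. Since
          \<open>\<box>D\<close> is not, this later excludes
          \<open>\<box>(D \<rightarrow> \<box>D)\<close> from \<open>w\<close>.\<close>
        then have D: "D \<in> w" using sat Box.IH[OF sub Box.prems(2)] Box.prems(2) by simp
        define S where "S = {\<^bold>\<box> B | B. \<^bold>\<box> B \<in> w}"
        have S: "S \<subseteq> range Box" "S \<subseteq> w" by (auto simp: S_def)
        define G where "G = insert (Neg D) (insert (\<^bold>\<box> (D \<^bold>\<rightarrow> \<^bold>\<box> D)) S)"
        \<comment> \<open>If \<open>G\<close> were inconsistent, the boxes of \<open>w\<close> would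
          derive the premise of the Grz axiom for \<open>D\<close>, hence \<open>D\<close> and then
          \<open>\<box>D\<close>.\<close>
        have "\<not> derives G \<^bold>\<bottom>"
        proof
          assume "derives G \<^bold>\<bottom>"
          then have "derives S (\<^bold>\<box> (D \<^bold>\<rightarrow> \<^bold>\<box> D) \<^bold>\<rightarrow> Neg D \<^bold>\<rightarrow> \<^bold>\<bottom>)"
            unfolding G_def by (intro derives_ded)
          moreover have "derives S ((\<^bold>\<box> (D \<^bold>\<rightarrow> \<^bold>\<box> D) \<^bold>\<rightarrow> Neg D \<^bold>\<rightarrow> \<^bold>\<bottom>) \<^bold>\<rightarrow> \<^bold>\<box> (D \<^bold>\<rightarrow> \<^bold>\<box> D) \<^bold>\<rightarrow> D)"
            by (rule derives_taut) (auto simp: tautology_def)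
          ultimately have "derives S (\<^bold>\<box> (D \<^bold>\<rightarrow> \<^bold>\<box> D) \<^bold>\<rightarrow> D)" using derives_mp by blast
          then have "derives S (\<^bold>\<box> (\<^bold>\<box> (D \<^bold>\<rightarrow> \<^bold>\<box> D) \<^bold>\<rightarrow> D))" by (rule derives_boxed_nec[OF S(1)])
          then have "derives S D" by (rule derives_mp[OF derives_Grz[OF Grz_instance]])
          then have "derives S (\<^bold>\<box> D)" by (rule derives_boxed_nec[OF S(1)])
          then show False using closed[OF Box.prems(2) derives_mono[OF _ S(2)] X(2)] nbox by blast
        qed
        from extend[OF this] obtain u
          where u: "u \<in> W" "G \<inter> X \<subseteq> u" "\<And>C. C \<in> X \<Longrightarrow> Neg C \<in> G \<Longrightarrow> C \<notin> u" by blast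
        have "D \<notin> u" using u(3)[OF X(1)] by (simp add: G_def)
        have "\<^bold>\<box> (D \<^bold>\<rightarrow> \<^bold>\<box> D) \<notin> w"
        proof
          assume "\<^bold>\<box> (D \<^bold>\<rightarrow> \<^bold>\<box> D) \<in> w"
          then have "derives w (D \<^bold>\<rightarrow> \<^bold>\<box> D)"
            by (rule derives_mp[OF derives_Grz[OF Grz_T] derives_assm])
          then have "derives w (\<^bold>\<box> D)" using D derives_mp derives_assm by blast
          then show False using closed[OF Box.prems(2) _ X(2)] nbox by blast
        qed
        moreover have "\<^bold>\<box> (D \<^bold>\<rightarrow> \<^bold>\<box> D) \<in> u" using u(2) X(3) by (auto simp: G_def)
        moreover have "\<^bold>\<box> B \<in> u" if "\<^bold>\<box> B \<in> w" for B
          using u(2) that Box.prems(2) by (auto simp: G_def S_def W_def)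
        ultimately have "R w u" by (auto simp: R_def)
        then show False using sat u(1) \<open>D \<notin> u\<close> Box.IH[OF sub u(1)] by simp
      qed
    qed
  qed
  have "\<not> derives {Neg A} \<^bold>\<bottom>"
  proof
    assume "derives {Neg A} \<^bold>\<bottom>"
    then have "Neg A \<^bold>\<rightarrow> \<^bold>\<bottom> \<in> Grz" using derives_ded derives_empty by blast
    then have "A \<in> Grz" by (rule Grz_conseq1) auto
    then show False using assms by blast
  qed
  from extend[OF this] obtain w where "w \<in> W" "A \<notin> w"
    using Sub_refl by (auto simp: X_def)
  then show thesis using that[OF poset] truth[OF Sub_refl] by blast
qed

section \<open>Finitely many formulas of bounded depth up to equivalence\<close>

definition bounded_fms :: "nat \<Rightarrow> nat set \<Rightarrow> nat set \<Rightarrow> fm set" where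
  "bounded_fms k S T = {A. mdepth A \<le> k \<and> vpos A \<subseteq> S \<and> vneg A \<subseteq> T}"

lemma bounded_fms_mono: "k \<le> l \<Longrightarrow> bounded_fms k S T \<subseteq> bounded_fms l S T"
  by (auto simp: bounded_fms_def)

primrec Disj :: "fm list \<Rightarrow> fm" where
  "Disj [] = \<^bold>\<bottom>"
| "Disj (A # As) = Neg A \<^bold>\<rightarrow> Disj As"

primrec Conj :: "fm list \<Rightarrow> fm" where
  "Conj [] = Neg \<^bold>\<bottom>"
| "Conj (A # As) = Neg (A \<^bold>\<rightarrow> Neg (Conj As))"

lemma sat_Disj [simp]: "sat W R V w (Disj As) \<longleftrightarrow> (\<exists>A\<in>set As. sat W R V w A)"
  by (induction As) auto

lemma sat_Conj [simp]: "sat W R V w (Conj As) \<longleftrightarrow> (\<forall>A\<in>set As. sat W R V w A)"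
  by (induction As) auto

lemma Disj_bounded: "set As \<subseteq> bounded_fms k S T \<Longrightarrow> Disj As \<in> bounded_fms k S T"
  by (induction As) (auto simp: bounded_fms_def)

lemma Conj_bounded: "set As \<subseteq> bounded_fms k S T \<Longrightarrow> Conj As \<in> bounded_fms k S T"
  by (induction As) (auto simp: bounded_fms_def)

definition Grz_equiv :: "fm \<Rightarrow> fm \<Rightarrow> bool" where
  "Grz_equiv A B \<longleftrightarrow> A \<^bold>\<rightarrow> B \<in> Grz \<and> B \<^bold>\<rightarrow> A \<in> Grz"

lemma Grz_equiv_sym: "Grz_equiv A B \<Longrightarrow> Grz_equiv B A"
  by (simp add: Grz_equiv_def)

lemma Grz_imp_trans: "A \<^bold>\<rightarrow> B \<in> Grz \<Longrightarrow> B \<^bold>\<rightarrow> C \<in> Grz \<Longrightarrow> A \<^bold>\<rightarrow> C \<in> Grz"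
  by (rule Grz_conseq2[of "A \<^bold>\<rightarrow> B" "B \<^bold>\<rightarrow> C"]) auto

lemma Grz_equiv_trans: "Grz_equiv A B \<Longrightarrow> Grz_equiv B C \<Longrightarrow> Grz_equiv A C"
  unfolding Grz_equiv_def using Grz_imp_trans by blast

lemma (in finite_poset) Grz_equiv_sat:
  "Grz_equiv A B \<Longrightarrow> w \<in> W \<Longrightarrow> sat W R V w A = sat W R V w B"
  unfolding Grz_equiv_def using Grz_sound[of "A \<^bold>\<rightarrow> B"] Grz_sound[of "B \<^bold>\<rightarrow> A"] by auto

text \<open>Worlds of type \<open>fm set\<close> suffice because the countermodels given by
  completeness have that type.\<close>

lemma Grz_validI:
  assumes "\<And>(W :: fm set set) R V w. finite_poset W R \<Longrightarrow> w \<in> W \<Longrightarrow> sat W R V w A"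
  shows "A \<in> Grz"
  by (rule ccontr, erule Grz_complete) (erule (1) notE[OF _ assms])

lemma Grz_equivI:
  assumes "\<And>(W :: fm set set) R V w. finite_poset W R \<Longrightarrow> w \<in> W \<Longrightarrow> sat W R V w A = sat W R V w B"
  shows "Grz_equiv A B"
  unfolding Grz_equiv_def by (intro conjI Grz_validI) (simp_all add: assms)

text \<open>A formula is a Boolean combination of variables and boxes of smaller depth. Replacing
  the boxed bodies by finitely many representatives leaves finitely many truth tables.\<close>

lemma finitely_many_fms_of_depth:
  assumes "finite U"
  shows "\<exists>F. finite F \<and>
    (\<forall>A. mdepth A < k \<longrightarrow> vpos A \<union> vneg A \<subseteq> U \<longrightarrow> (\<exists>B\<in>F. Grz_equiv A B))"
proof (induction k)
  case 0
  then show ?case by auto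
next
  case (Suc k)
  then obtain F where finF: "finite F" and
    F: "\<And>A. mdepth A < k \<Longrightarrow> vpos A \<union> vneg A \<subseteq> U \<Longrightarrow> \<exists>B\<in>F. Grz_equiv A B"
    by blast
  define rep where "rep A = (SOME B. B \<in> F \<and> Grz_equiv A B)" for A
  have rep: "rep A \<in> F" "Grz_equiv A (rep A)" if "mdepth A < k" "vpos A \<union> vneg A \<subseteq> U" for A
    using someI_ex[of "\<lambda>B. B \<in> F \<and> Grz_equiv A B"] F[OF that] unfolding rep_def by auto
  \<comment> \<open>The truth table of \<open>A\<close> over the variables in \<open>U\<close> and the boxed representatives.\<close>
  define \<tau> where
    "\<tau> A = {(v, b). v \<subseteq> U \<and> b \<subseteq> F \<and> peval (\<lambda>p. p \<in> v) (\<lambda>C. rep C \<in> b) A}" for A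
  define X where "X = {A. mdepth A < Suc k \<and> vpos A \<union> vneg A \<subseteq> U}"
  have \<tau>: "sat W R V w A \<longleftrightarrow> ({p \<in> U. V w p}, {C \<in> F. sat W R V w (\<^bold>\<box> C)}) \<in> \<tau> A"
    if "finite_poset W R" "w \<in> W" "A \<in> X" for W :: "fm set set" and R V w A
  proof -
    have "sat W R V w A \<longleftrightarrow>
      peval (\<lambda>p. p \<in> {p \<in> U. V w p}) (\<lambda>C. rep C \<in> {C \<in> F. sat W R V w (\<^bold>\<box> C)}) A"
      using that(3)
    proof (induction A)
      case (Box C)
      then have "mdepth C < k" "vpos C \<union> vneg C \<subseteq> U" by (auto simp: X_def)
      note r = rep[OF this]
      from finite_poset.Grz_equiv_sat[OF that(1) r(2)]
      have "sat W R V w (\<^bold>\<box> C) = sat W R V w (\<^bold>\<box> (rep C))" by simp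
      then show ?case using r(1) by simp
    qed (auto simp: X_def)
    then show ?thesis by (simp add: \<tau>_def)
  qed
  have "\<tau> ` X \<subseteq> Pow (Pow U \<times> Pow F)" by (auto simp: \<tau>_def)
  then have "finite (\<tau> ` X)" by (rule finite_subset) (simp add: finF assms)
  \<comment> \<open>\<open>Y\<close> picks a formula for each truth table that occurs.\<close>
  from finite_subset_image[OF this subset_refl] obtain Y
    where Y: "Y \<subseteq> X" "finite Y" "\<tau> ` X = \<tau> ` Y" by blast
  have "\<exists>B\<in>Y. Grz_equiv A B" if "A \<in> X" for A
  proof -
    from that Y(3) obtain B where B: "B \<in> Y" "\<tau> A = \<tau> B" by blast
    then have "B \<in> X" using Y(1) by blast
    have "Grz_equiv A B"
    proof (rule Grz_equivI)
      fix W :: "fm set set" and R V w assume "finite_poset W R" "w \<in> W"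
      then show "sat W R V w A = sat W R V w B"
        using \<tau>[of W R w A V] \<tau>[of W R w B V] that \<open>B \<in> X\<close> B(2) by simp
    qed
    with B(1) show ?thesis by blast
  qed
  then show ?case using Y(2) by (auto simp: X_def)
qed

text \<open>The representatives found above respect neither polarity nor membership in
  \<open>G\<close>, so one member of \<open>G\<close> is chosen from each class that meets
  \<open>G\<close>.\<close>

lemma finite_representatives:
  assumes "finite S" "finite T" "G \<subseteq> bounded_fms k S T"
  obtains F where "finite F" "F \<subseteq> G" "\<And>A. A \<in> G \<Longrightarrow> \<exists>B\<in>F. Grz_equiv A B"
proof -
  obtain F where finF: "finite F" and
    F: "\<And>A. mdepth A < Suc k \<Longrightarrow> vpos A \<union> vneg A \<subseteq> S \<union> T \<Longrightarrow> \<exists>B\<in>F. Grz_equiv A B"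
    using finitely_many_fms_of_depth[of "S \<union> T" "Suc k"] assms by blast
  define rep where "rep A = (SOME B. B \<in> F \<and> Grz_equiv A B)" for A
  have rep: "rep A \<in> F \<and> Grz_equiv A (rep A)" if "A \<in> G" for A
  proof -
    have "mdepth A < Suc k" "vpos A \<union> vneg A \<subseteq> S \<union> T"
      using that assms(3) by (auto simp: bounded_fms_def)
    from F[OF this] show ?thesis
      using someI_ex[of "\<lambda>B. B \<in> F \<and> Grz_equiv A B"] unfolding rep_def by auto
  qed
  then have "finite (rep ` G)" by (intro finite_subset[OF _ finF]) blast
  from finite_subset_image[OF this subset_refl] obtain Y
    where Y: "Y \<subseteq> G" "finite Y" "rep ` G = rep ` Y" by blast
  have "\<exists>B\<in>Y. Grz_equiv A B" if "A \<in> G" for A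
  proof -
    from that Y(3) obtain B where B: "B \<in> Y" "rep A = rep B" by blast
    then have "Grz_equiv A (rep B)" "Grz_equiv B (rep B)" using rep[OF that] rep[of B] Y(1) by auto
    then have "Grz_equiv A B" using Grz_equiv_sym Grz_equiv_trans by blast
    with B(1) show ?thesis by blast
  qed
  with Y show thesis using that by blast
qed

section \<open>Amalgamation of layered simulations\<close>

locale amalgam = K1: finite_poset W1 R1 + K2: finite_poset W2 R2
  for W1 :: "'a set" and R1 and W2 :: "'b set" and R2 +
  fixes V1 :: "'a \<Rightarrow> nat \<Rightarrow> bool" and V2 :: "'b \<Rightarrow> nat \<Rightarrow> bool"
    and A :: fm and P Q :: "nat set"
begin

section \<open>Layered simulations between two models\<close>

abbreviation "sat1 \<equiv> sat W1 R1 V1"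
abbreviation "sat2 \<equiv> sat W2 R2 V2"

text \<open>The simulation is defined by preservation of formulas; its back and forth conditions are
  derived, at the cost of one layer each.\<close>

definition sim :: "nat \<Rightarrow> 'a \<Rightarrow> 'b \<Rightarrow> bool" where
  "sim k x y \<longleftrightarrow> (\<forall>C\<in>bounded_fms k (vpos A - P) (vneg A - Q). sat1 x C \<longrightarrow> sat2 y C)"

lemma sim_mono: "sim l x y \<Longrightarrow> k \<le> l \<Longrightarrow> sim k x y"
  using bounded_fms_mono unfolding sim_def by blast

text \<open>Otherwise every successor of \<open>x\<close> has a formula separating it from
  \<open>y'\<close>. The box of their finite disjunction holds at \<open>x\<close>, so it holds at
  \<open>y\<close>, contradicting its failure at \<open>y'\<close>.\<close>

lemma sim_back:
  assumes "sim (Suc k) x y" "x \<in> W1" "y' \<in> W2" "R2 y y'"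
  shows "\<exists>x'\<in>W1. R1 x x' \<and> sim k x' y'"
proof (rule ccontr)
  assume "\<not> ?thesis"
  then have "\<forall>x'\<in>{x'\<in>W1. R1 x x'}. \<exists>C. C \<in> bounded_fms k (vpos A - P) (vneg A - Q) \<and>
      sat1 x' C \<and> \<not> sat2 y' C"
    by (auto simp: sim_def)
  from bchoice[OF this] obtain c where c: "\<forall>x'\<in>{x'\<in>W1. R1 x x'}.
      c x' \<in> bounded_fms k (vpos A - P) (vneg A - Q) \<and> sat1 x' (c x') \<and> \<not> sat2 y' (c x')" ..
  obtain Cs where Cs: "set Cs = c ` {x'\<in>W1. R1 x x'}"
    using finite_list[of "c ` {x'\<in>W1. R1 x x'}"] K1.finite_worlds by auto
  have "Disj Cs \<in> bounded_fms k (vpos A - P) (vneg A - Q)"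
    using c Cs by (intro Disj_bounded) auto
  then have "\<^bold>\<box> (Disj Cs) \<in> bounded_fms (Suc k) (vpos A - P) (vneg A - Q)"
    by (simp add: bounded_fms_def)
  moreover have "sat1 x (\<^bold>\<box> (Disj Cs))" using c Cs by auto
  ultimately have "sat2 y (\<^bold>\<box> (Disj Cs))" using assms(1) unfolding sim_def by blast
  then have "sat2 y' (Disj Cs)" using assms by simp
  then show False using c Cs by auto
qed

text \<open>Dual to \<open>sim_back\<close>: a diamond, written as a doubly negated box and so
  polarity-preserving, over the conjunction of the separating formulas.\<close>

lemma sim_forth:
  assumes "sim (Suc k) x y" "x' \<in> W1" "R1 x x'" "y \<in> W2"
  shows "\<exists>y'\<in>W2. R2 y y' \<and> sim k x' y'"
proof (rule ccontr)
  assume "\<not> ?thesis"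
  then have "\<forall>y'\<in>{y'\<in>W2. R2 y y'}. \<exists>C. C \<in> bounded_fms k (vpos A - P) (vneg A - Q) \<and>
      sat1 x' C \<and> \<not> sat2 y' C"
    by (auto simp: sim_def)
  from bchoice[OF this] obtain c where c: "\<forall>y'\<in>{y'\<in>W2. R2 y y'}.
      c y' \<in> bounded_fms k (vpos A - P) (vneg A - Q) \<and> sat1 x' (c y') \<and> \<not> sat2 y' (c y')" ..
  obtain Cs where Cs: "set Cs = c ` {y'\<in>W2. R2 y y'}"
    using finite_list[of "c ` {y'\<in>W2. R2 y y'}"] K2.finite_worlds by auto
  have "Conj Cs \<in> bounded_fms k (vpos A - P) (vneg A - Q)"
    using c Cs by (intro Conj_bounded) auto
  then have "Neg (\<^bold>\<box> (Neg (Conj Cs))) \<in> bounded_fms (Suc k) (vpos A - P) (vneg A - Q)"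
    by (simp add: bounded_fms_def)
  moreover have "sat1 x (Neg (\<^bold>\<box> (Neg (Conj Cs))))" using c Cs assms(2,3) by auto
  ultimately have "sat2 y (Neg (\<^bold>\<box> (Neg (Conj Cs))))" using assms(1) unfolding sim_def by blast
  then obtain y' where "y' \<in> W2" "R2 y y'" "sat2 y' (Conj Cs)" by auto
  then show False using c Cs by auto
qed

lemma sim_vpos: "sim k x y \<Longrightarrow> p \<in> vpos A - P \<Longrightarrow> V1 x p \<Longrightarrow> V2 y p"
  unfolding sim_def by (drule bspec[of _ _ "Var p"]) (auto simp: bounded_fms_def)

lemma sim_vneg: "sim k x y \<Longrightarrow> p \<in> vneg A - Q \<Longrightarrow> V2 y p \<Longrightarrow> V1 x p"
  unfolding sim_def by (drule bspec[of _ _ "Neg (Var p)"]) (auto simp: bounded_fms_def)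

section \<open>Failing boxes and their rank\<close>

definition unboxed :: "'a \<Rightarrow> fm set" where
  "unboxed x = {C. \<^bold>\<box> C \<in> Sub A \<and> \<not> sat1 x (\<^bold>\<box> C)}"

definition rank :: "'a \<Rightarrow> nat" where
  "rank x = card (unboxed x)"

lemma finite_unboxed: "finite (unboxed x)"
  by (rule finite_subset[OF _ finite_boxed_Sub[of A]]) (auto simp: unboxed_def)

lemma rank_le_nbox: "rank x \<le> nbox A"
  unfolding rank_def nbox_def unboxed_def by (rule card_mono[OF finite_boxed_Sub]) auto

lemma unboxed_antimono: "x \<in> W1 \<Longrightarrow> u \<in> W1 \<Longrightarrow> R1 x u \<Longrightarrow> unboxed u \<subseteq> unboxed x"
  unfolding unboxed_def using K1.sat_box_mono by blast

lemma rank_mono: "unboxed u \<subseteq> unboxed x \<Longrightarrow> rank u \<le> rank x"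
  unfolding rank_def by (rule card_mono[OF finite_unboxed])

lemma rank_strict_mono: "unboxed u \<subset> unboxed x \<Longrightarrow> rank u < rank x"
  unfolding rank_def by (rule psubset_card_mono[OF finite_unboxed])

lemma rank_pos: "unboxed x \<noteq> {} \<Longrightarrow> 0 < rank x"
  unfolding rank_def using finite_unboxed by (simp add: card_gt_0_iff)

text \<open>The last points with a given set of failing boxes. Nonemptiness makes the rank positive,
  so that \<open>3 * rank x - 2\<close> is not truncated.\<close>

definition unboxed_maximal :: "'a \<Rightarrow> bool" where
  "unboxed_maximal x \<longleftrightarrow> unboxed x \<noteq> {} \<and> (\<forall>u\<in>W1. R1 x u \<longrightarrow> u \<noteq> x \<longrightarrow> unboxed u \<subset> unboxed x)"

text \<open>Take \<open>u\<close> maximal among the points refuting \<open>C\<close>. Every proper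
  successor of \<open>u\<close> satisfies \<open>\<box>C\<close>, while \<open>u\<close> itself does
  not, so the set of failing boxes drops.\<close>

lemma refuting_maximal:
  assumes "x \<in> W1" "C \<in> unboxed x"
  obtains u where "u \<in> W1" "R1 x u" "\<not> sat1 u C" "unboxed_maximal u"
proof -
  from assms obtain z where z: "z \<in> W1" "R1 x z" "\<not> sat1 z C" by (auto simp: unboxed_def)
  obtain u where u: "u \<in> W1" "R1 z u" "\<not> sat1 u C"
    and mx: "\<And>v. v \<in> W1 \<Longrightarrow> R1 u v \<Longrightarrow> \<not> sat1 v C \<Longrightarrow> v = u"
    using K1.maximal_above[of z "\<lambda>u. \<not> sat1 u C"] z by blast
  have Cu: "C \<in> unboxed u" using u assms K1.refl by (auto simp: unboxed_def)
  have "unboxed v \<subset> unboxed u" if v: "v \<in> W1" "R1 u v" "v \<noteq> u" for v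
  proof -
    have "sat1 v (\<^bold>\<box> C)"
    proof (simp, intro ballI impI)
      fix t assume t: "t \<in> W1" "R1 v t"
      then have "t \<noteq> u" using v u(1) K1.antisym by blast
      moreover have "R1 u t" using K1.trans u(1) v t by blast
      ultimately show "sat1 t C" using mx t(1) by blast
    qed
    then have "C \<notin> unboxed v" by (simp add: unboxed_def)
    then show ?thesis using Cu unboxed_antimono[OF u(1) v(1,2)] by blast
  qed
  then have "unboxed_maximal u" using Cu by (auto simp: unboxed_maximal_def)
  moreover have "R1 x u" using K1.trans assms(1) z u by blast
  ultimately show thesis using that u by blast
qed

section \<open>The partial order of pairs\<close>

text \<open>The levels are chosen so that every step consuming one level lands again in a world.
  The points \<open>x0\<close>, \<open>y0\<close> are anchors: a move of the second component that keeps \<open>unboxed\<close> fixed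
  is answered from the anchor and not from the current pair, so it can be repeated without
  consuming further levels. Worlds flagged \<open>True\<close> have an \<open>unboxed_maximal\<close> first component, so that
  the remaining refutations are found at points of smaller rank.\<close>

definition worlds :: "('a \<times> 'b \<times> bool) set" where
  "worlds =
    {(x, y, False) | x y. x \<in> W1 \<and> y \<in> W2 \<and> sim (3 * rank x) x y \<and>
      (\<exists>x0\<in>W1. \<exists>y0\<in>W2. R1 x0 x \<and> R2 y0 y \<and> unboxed x0 = unboxed x \<and> sim (3 * rank x + 1) x0 y0)}
    \<union> {(x, y, True) | x y. x \<in> W1 \<and> y \<in> W2 \<and> unboxed_maximal x \<and> sim (3 * rank x - 2) x y \<and>
      (\<exists>y0\<in>W2. R2 y0 y \<and> sim (3 * rank x - 1) x y0)}"

text \<open>First components are compared through \<open>unboxed\<close> and not by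
  \<open>R1\<close>, because an answer found from the anchor need not lie above the current
  \<open>x\<close>. The flag and the second component order the pairs with equal
  \<open>unboxed\<close>.\<close>

definition rel :: "'a \<times> 'b \<times> bool \<Rightarrow> 'a \<times> 'b \<times> bool \<Rightarrow> bool" where
  "rel = (\<lambda>(x, y, b) (x', y', b'). (x, y, b) = (x', y', b') \<or>
     R2 y y' \<and> (unboxed x' \<subset> unboxed x \<or>
       unboxed x' = unboxed x \<and> (\<not> b \<and> b' \<or> b = b' \<and> y \<noteq> y')))"

text \<open>The first disjunct makes positive variables of \<open>A\<close> inherit truth from
  \<open>x\<close>; the second does the same from \<open>y\<close> for variables outside
  \<open>Q\<close>. The converses that the truth lemmas need come from \<open>sim_vpos\<close> and
  \<open>sim_vneg\<close>.\<close>

definition val :: "'a \<times> 'b \<times> bool \<Rightarrow> nat \<Rightarrow> bool" where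
  "val = (\<lambda>(x, y, b) p. p \<in> vpos A \<and> V1 x p \<or> p \<notin> Q \<and> V2 y p)"

lemma worldsD: "(x, y, b) \<in> worlds \<Longrightarrow> x \<in> W1 \<and> y \<in> W2 \<and> (\<exists>k. sim k x y)"
  by (auto simp: worlds_def)

lemma anchor_world:
  assumes "x \<in> W1" "y \<in> W2" "sim (3 * rank x + 1) x y"
  shows "(x, y, False) \<in> worlds"
proof -
  have "sim (3 * rank x) x y" using assms(3) by (rule sim_mono) simp
  then show ?thesis using assms K1.refl K2.refl by (auto simp: worlds_def)
qed

lemma maximal_world:
  assumes "x \<in> W1" "y \<in> W2" "unboxed_maximal x" "sim (3 * rank x - 1) x y"
  shows "(x, y, True) \<in> worlds"
proof -
  have "sim (3 * rank x - 2) x y" using assms(4) by (rule sim_mono) simp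
  then show ?thesis using assms K2.refl by (auto simp: worlds_def)
qed

lemma rel_neqD:
  "rel (x, y, b) (x', y', b') \<Longrightarrow> (x, y, b) \<noteq> (x', y', b') \<Longrightarrow>
    R2 y y' \<and> (unboxed x' \<subset> unboxed x \<or>
      unboxed x' = unboxed x \<and> (\<not> b \<and> b' \<or> b = b' \<and> y \<noteq> y'))"
  unfolding rel_def split by (erule disjE) simp_all

text \<open>Each proper step is irreversible: \<open>unboxed\<close> shrinks, or it stays fixed and
  the flag rises, or both stay fixed and the second component moves strictly up.\<close>

lemma finite_poset_worlds: "finite_poset worlds rel"
proof
  have "worlds \<subseteq> W1 \<times> W2 \<times> UNIV" by (auto dest: worldsD)
  then show "finite worlds"
    by (rule finite_subset) (simp add: K1.finite_worlds K2.finite_worlds)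
next
  fix s assume "s \<in> worlds"
  then show "rel s s" by (cases s) (simp add: rel_def)
next
  fix s t assume "s \<in> worlds" "t \<in> worlds" "rel s t" "rel t s"
  moreover obtain x y b x' y' b' where "s = (x, y, b)" "t = (x', y', b')" by (metis prod_cases3)
  ultimately show "s = t" using worldsD[of x y b] worldsD[of x' y' b'] K2.antisym[of y y']
    by (auto simp: rel_def)
next
  fix s t r assume st: "s \<in> worlds" "t \<in> worlds" "r \<in> worlds" "rel s t" "rel t r"
  obtain x y b x' y' b' x'' y'' b''
    where eq: "s = (x, y, b)" "t = (x', y', b')" "r = (x'', y'', b'')" by (metis prod_cases3)
  have W: "y \<in> W2" "y' \<in> W2" "y'' \<in> W2" using st worldsD unfolding eq by blast+
  show "rel s r"
  proof (cases "s = t \<or> t = r")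
    case True
    then show ?thesis using st by blast
  next
    case False
    then have R: "R2 y y'" "R2 y' y''"
      and U: "unboxed x' \<subset> unboxed x \<or> unboxed x' = unboxed x \<and> (\<not> b \<and> b' \<or> b = b' \<and> y \<noteq> y')"
      and U': "unboxed x'' \<subset> unboxed x' \<or>
        unboxed x'' = unboxed x' \<and> (\<not> b' \<and> b'' \<or> b' = b'' \<and> y' \<noteq> y'')"
      using rel_neqD[of x y b x' y' b'] rel_neqD[of x' y' b' x'' y'' b''] st(4,5) unfolding eq by blast+
    have "R2 y y''" using K2.trans W R by blast
    moreover have "y = y'' \<longrightarrow> y = y'" using K2.antisym W R by blast
    with U U' have "unboxed x'' \<subset> unboxed x \<or>
        unboxed x'' = unboxed x \<and> (\<not> b \<and> b'' \<or> b = b'' \<and> y \<noteq> y'')"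
      using psubset_trans[of "unboxed x''" "unboxed x'" "unboxed x"] by (elim disjE conjE) simp_all
    ultimately show ?thesis by (simp add: eq rel_def)
  qed
qed

text \<open>The answer comes from the anchor by \<open>sim_back\<close>. If \<open>unboxed\<close>
  stays fixed (unflagged) or the first component stays fixed (flagged), the old anchor is kept;
  otherwise the rank drops and the new pair is its own anchor.\<close>

lemma rel_back:
  assumes s: "(x, y, b) \<in> worlds" and y': "y' \<in> W2" "R2 y y'"
  obtains x' b' where "(x', y', b') \<in> worlds" "rel (x, y, b) (x', y', b')"
proof (cases "y' = y")
  case True
  then show ?thesis using that s by (auto simp: rel_def)
next
  case neq: False
  show ?thesis
  proof (cases b)
    case False
    with s obtain x0 y0 where W: "x \<in> W1" "y \<in> W2" "x0 \<in> W1" "y0 \<in> W2" "R1 x0 x" "R2 y0 y"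
      "unboxed x0 = unboxed x" "sim (3 * rank x + 1) x0 y0" by (auto simp: worlds_def)
    have "R2 y0 y'" using K2.trans W y' by blast
    then obtain x' where x': "x' \<in> W1" "R1 x0 x'" "sim (3 * rank x) x' y'"
      using sim_back[of "3 * rank x" x0 y0 y'] W y' by auto
    have U: "unboxed x' \<subseteq> unboxed x" using unboxed_antimono[of x0 x'] W x' by auto
    show ?thesis
    proof (cases "unboxed x' = unboxed x")
      case True
      then have "rank x' = rank x" by (simp add: rank_def)
      then have "(x', y', False) \<in> worlds"
        using W x' y' True \<open>R2 y0 y'\<close> unfolding worlds_def by auto
      then show ?thesis using that y' neq True False by (auto simp: rel_def)
    next
      case strict: False
      then have U': "unboxed x' \<subset> unboxed x" using U by blast
      then have "rank x' < rank x" by (rule rank_strict_mono)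
      then have "sim (3 * rank x' + 1) x' y'" by (intro sim_mono[OF x'(3)]) simp
      then have "(x', y', False) \<in> worlds" using anchor_world x' y' by blast
      then show ?thesis using that y' U' by (auto simp: rel_def)
    qed
  next
    case True
    with s obtain y0 where W: "x \<in> W1" "y \<in> W2" "y0 \<in> W2" "R2 y0 y"
      "unboxed_maximal x" "sim (3 * rank x - 1) x y0" by (auto simp: worlds_def)
    have pos: "0 < rank x" using W(5) rank_pos by (simp add: unboxed_maximal_def)
    then have suc: "3 * rank x - 1 = Suc (3 * rank x - 2)" by linarith
    have "R2 y0 y'" using K2.trans W y' by blast
    then obtain x' where x': "x' \<in> W1" "R1 x x'" "sim (3 * rank x - 2) x' y'"
      using sim_back[of "3 * rank x - 2" x y0 y'] W y' unfolding suc by auto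
    show ?thesis
    proof (cases "x' = x")
      case eq: True
      then have "(x', y', True) \<in> worlds" using W x' y' \<open>R2 y0 y'\<close> by (auto simp: worlds_def)
      then show ?thesis using that y' neq True eq by (auto simp: rel_def)
    next
      case False
      then have U: "unboxed x' \<subset> unboxed x" using W(5) x' by (simp add: unboxed_maximal_def)
      then have "rank x' < rank x" by (rule rank_strict_mono)
      \<comment> \<open>The tight case for three layers per rank: a drop by one gives exactly
        \<open>3 * rank x' + 1 = 3 * rank x - 2\<close>.\<close>
      then have "sim (3 * rank x' + 1) x' y'" by (intro sim_mono[OF x'(3)]) simp
      then have "(x', y', False) \<in> worlds" using anchor_world x' y' by blast
      then show ?thesis using that y' U by (auto simp: rel_def)
    qed
  qed
qed

text \<open>Unless \<open>x\<close> itself refutes \<open>C\<close>, move to an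
  \<open>unboxed_maximal\<close> point refuting \<open>C\<close> and match it by
  \<open>sim_forth\<close>. The target is always flagged.\<close>

lemma rel_forth:
  assumes s: "(x, y, b) \<in> worlds" and C: "C \<in> unboxed x"
  obtains x' y' b' where "(x', y', b') \<in> worlds" "rel (x, y, b) (x', y', b')" "\<not> sat1 x' C"
proof (cases "sat1 x C")
  case False
  then show ?thesis using that s by (auto simp: rel_def)
next
  case True
  have W: "x \<in> W1" "y \<in> W2" using worldsD[OF s] by auto
  obtain u where u: "u \<in> W1" "R1 x u" "\<not> sat1 u C" "unboxed_maximal u"
    using refuting_maximal[OF W(1) C] by blast
  have pos: "0 < rank u" using u(4) rank_pos by (simp add: unboxed_maximal_def)
  have U: "unboxed u \<subseteq> unboxed x" using unboxed_antimono W u by blast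
  show ?thesis
  proof (cases b)
    case False
    then have "sim (3 * rank x) x y" using s by (auto simp: worlds_def)
    moreover have "3 * rank x = Suc (3 * rank x - 1)" using pos rank_mono[OF U] by linarith
    ultimately obtain y' where y': "y' \<in> W2" "R2 y y'" "sim (3 * rank x - 1) u y'"
      using sim_forth[of "3 * rank x - 1" x y u] W u by auto
    have "sim (3 * rank u - 1) u y'" using rank_mono[OF U] by (intro sim_mono[OF y'(3)]) simp
    then have "(u, y', True) \<in> worlds" using maximal_world u y' by blast
    \<comment> \<open>Raising the flag makes the pairs related even if \<open>unboxed\<close> is
      unchanged.\<close>
    then show ?thesis using that u(3) U y' False by (auto simp: rel_def)
  next
    case b: True
    then have max: "unboxed_maximal x" "sim (3 * rank x - 2) x y" using s by (auto simp: worlds_def)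
    \<comment> \<open>From a flagged world the flag cannot rise again, but \<open>C\<close>
      separates \<open>u\<close> from \<open>x\<close>, so maximality of \<open>x\<close> forces a
      drop in rank.\<close>
    have "u \<noteq> x" using u(3) True by blast
    then have U: "unboxed u \<subset> unboxed x" using max u by (simp add: unboxed_maximal_def)
    then have rk: "rank u < rank x" by (rule rank_strict_mono)
    then have "3 * rank x - 2 = Suc (3 * rank x - 3)" using pos by linarith
    then obtain y' where y': "y' \<in> W2" "R2 y y'" "sim (3 * rank x - 3) u y'"
      using sim_forth[of "3 * rank x - 3" x y u] W u max by auto
    have "sim (3 * rank u - 1) u y'" using rk by (intro sim_mono[OF y'(3)]) simp
    then have "(u, y', True) \<in> worlds" using maximal_world u y' by blast
    then show ?thesis using that u(3) U y' by (auto simp: rel_def)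
  qed
qed

section \<open>Truth lemmas for the two components\<close>

lemma rel_fst: "rel (x, y, b) (x', y', b') \<Longrightarrow> unboxed x' \<subseteq> unboxed x"
  by (auto simp: rel_def)

lemma rel_snd: "(x, y, b) \<in> worlds \<Longrightarrow> rel (x, y, b) (x', y', b') \<Longrightarrow> R2 y y'"
  using worldsD[of x y b] K2.refl[of y] by (auto simp: rel_def)

text \<open>Both directions are proved together because implication swaps polarities. For boxes,
  \<open>rel_back\<close> reflects successors and \<open>rel_snd\<close> projects them.\<close>

lemma sat_worlds_snd:
  assumes "(x, y, b) \<in> worlds"
  shows "vpos C \<inter> P = {} \<Longrightarrow> vneg C \<inter> Q = {} \<Longrightarrow> sat worlds rel val (x, y, b) C \<Longrightarrow> sat2 y C"
    and "vneg C \<inter> P = {} \<Longrightarrow> vpos C \<inter> Q = {} \<Longrightarrow> sat2 y C \<Longrightarrow> sat worlds rel val (x, y, b) C"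
  using assms
proof (induction C arbitrary: x y b)
  case (Var p)
  { case 1
    obtain k where "sim k x y" using worldsD[OF 1(4)] by blast
    from sim_vpos[OF this, of p] show ?case using 1 by (auto simp: val_def)
  next
    case 2 then show ?case by (simp add: val_def) }
next
  case Bot
  { case 1 then show ?case by simp
  next
    case 2 then show ?case by simp }
next
  case (Imp C D)
  { case 1 then show ?case using Imp.IH(2)[of y x b] Imp.IH(3)[of x y b] by auto
  next
    case 2 then show ?case using Imp.IH(1)[of x y b] Imp.IH(4)[of y x b] by auto }
next
  case (Box C)
  { case 1
    have "sat2 y' C" if y': "y' \<in> W2" "R2 y y'" for y'
    proof -
      obtain x' b' where "(x', y', b') \<in> worlds" "rel (x, y, b) (x', y', b')"
        using rel_back[OF 1(4) y'] .
      then show ?thesis using Box.IH(1)[of x' y' b'] 1 by simp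
    qed
    then show ?case by simp
  next
    case 2
    have "sat worlds rel val (x', y', b') C"
      if s': "(x', y', b') \<in> worlds" "rel (x, y, b) (x', y', b')" for x' y' b'
      using Box.IH(2)[of y' x' b'] 2 s' rel_snd[OF 2(4) s'(2)] worldsD[OF s'(1)] by simp
    then show ?case by auto }
qed

text \<open>The two parts treat positive and negative occurrences in \<open>A\<close>. False boxes
  get their witness from \<open>rel_forth\<close>.\<close>

lemma sat_worlds_fst:
  assumes "(x, y, b) \<in> worlds" "C \<in> Sub A"
  shows "vpos C \<subseteq> vpos A \<Longrightarrow> vneg C \<subseteq> vneg A \<Longrightarrow> sat1 x C \<Longrightarrow> sat worlds rel val (x, y, b) C"
    and "vpos C \<subseteq> vneg A \<Longrightarrow> vneg C \<subseteq> vpos A \<Longrightarrow> sat worlds rel val (x, y, b) C \<Longrightarrow> sat1 x C"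
  using assms
proof (induction C arbitrary: x y b)
  case (Var p)
  { case 1 then show ?case by (simp add: val_def)
  next
    case 2
    obtain k where "sim k x y" using worldsD[OF 2(4)] by blast
    from sim_vneg[OF this, of p] show ?case using 2 by (auto simp: val_def) }
next
  case Bot
  { case 1 then show ?case by simp
  next
    case 2 then show ?case by simp }
next
  case (Imp C D)
  { case 1
    then show ?case using Imp.IH(2)[of x y b] Imp.IH(3)[of x y b] Sub_ImpD[OF 1(5)] by simp
  next
    case 2
    then show ?case using Imp.IH(1)[of x y b] Imp.IH(4)[of x y b] Sub_ImpD[OF 2(5)] by simp }
next
  case (Box C)
  { case 1
    have "sat worlds rel val (x', y', b') C"
      if s': "(x', y', b') \<in> worlds" "rel (x, y, b) (x', y', b')" for x' y' b'
    proof -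
      \<comment> \<open>In place of \<open>R1 x x'\<close>: inclusion of the failing boxes keeps
        \<open>\<box>C\<close> true at \<open>x'\<close>, and reflexivity then gives
        \<open>C\<close> there.\<close>
      have "C \<notin> unboxed x'" using rel_fst[OF s'(2)] 1(3) by (auto simp: unboxed_def)
      then have "sat1 x' (\<^bold>\<box> C)" using 1(5) by (simp add: unboxed_def)
      then have "sat1 x' C" using worldsD[OF s'(1)] K1.refl by auto
      then show ?thesis using Box.IH(1)[of x' y' b'] 1 s' Sub_BoxD[OF 1(5)] by simp
    qed
    then show ?case by auto
  next
    case 2
    show ?case
    proof (rule ccontr)
      assume "\<not> sat1 x (\<^bold>\<box> C)"
      then have "C \<in> unboxed x" using 2(5) by (simp add: unboxed_def)
      then obtain x' y' b'
        where "(x', y', b') \<in> worlds" "rel (x, y, b) (x', y', b')" "\<not> sat1 x' C"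
        using rel_forth[OF 2(4)] by blast
      then show False using Box.IH(2)[of x' y' b'] 2 Sub_BoxD[OF 2(5)] by simp
    qed }
qed

text \<open>The pair of \<open>x\<close> and \<open>y\<close> is a world satisfying \<open>A\<close>
  and refuting \<open>B\<close>. The level \<open>3 * nbox A + 1\<close> covers the anchor level of
  any \<open>x\<close>, since \<open>rank x\<close> is at most \<open>nbox A\<close>.\<close>

lemma amalgamation:
  assumes "x \<in> W1" "y \<in> W2" "sim (3 * nbox A + 1) x y" "sat1 x A"
    and "vpos B \<inter> P = {}" "vneg B \<inter> Q = {}" "\<not> sat2 y B"
  shows "A \<^bold>\<rightarrow> B \<notin> Grz"
proof
  assume "A \<^bold>\<rightarrow> B \<in> Grz"
  have "sim (3 * rank x + 1) x y" using rank_le_nbox by (intro sim_mono[OF assms(3)]) simp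
  then have w: "(x, y, False) \<in> worlds" using anchor_world assms by blast
  have "sat worlds rel val (x, y, False) A" using sat_worlds_fst(1)[OF w Sub_refl] assms(4) by simp
  moreover have "sat worlds rel val (x, y, False) (A \<^bold>\<rightarrow> B)"
    using finite_poset.Grz_sound[OF finite_poset_worlds \<open>A \<^bold>\<rightarrow> B \<in> Grz\<close> w] .
  ultimately show False using sat_worlds_snd(1)[OF w assms(5,6)] assms(7) by simp
qed

end

section \<open>The interpolant\<close>

lemma finite_vpos_vneg: "finite (vpos A) \<and> finite (vneg A)"
  by (induction A) auto

lemma uniform_Lyndon_interpolant_exists:
  obtains C where "uniform_Lyndon_interpolant Grz A P Q C" "mdepth C \<le> 3 * nbox A + 1"
proof -
  let ?F = "bounded_fms (3 * nbox A + 1) (vpos A - P) (vneg A - Q)"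
  have fin: "finite (vpos A - P)" "finite (vneg A - Q)" using finite_vpos_vneg by auto
  obtain F where F: "finite F" "F \<subseteq> {C \<in> ?F. A \<^bold>\<rightarrow> C \<in> Grz}"
    "\<And>C. C \<in> {C \<in> ?F. A \<^bold>\<rightarrow> C \<in> Grz} \<Longrightarrow> \<exists>D\<in>F. Grz_equiv C D"
    using finite_representatives[OF fin, of "{C \<in> ?F. A \<^bold>\<rightarrow> C \<in> Grz}"] by blast
  obtain Cs where Cs: "set Cs = F" using finite_list[OF F(1)] by blast
  define C where "C = Conj Cs"
  have C: "C \<in> ?F" unfolding C_def using Cs F(2) by (intro Conj_bounded) auto
  have "A \<^bold>\<rightarrow> C \<in> Grz"
  proof (rule ccontr, erule Grz_complete)
    fix W :: "fm set set" and R V w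
    assume *: "finite_poset W R" "w \<in> W" "\<not> sat W R V w (A \<^bold>\<rightarrow> C)"
    then obtain D where "D \<in> F" "sat W R V w A" "\<not> sat W R V w D" using Cs by (auto simp: C_def)
    then show False using finite_poset.Grz_sound[OF *(1) _ *(2), of "A \<^bold>\<rightarrow> D" V] F(2) by auto
  qed
  moreover have "C \<^bold>\<rightarrow> B \<in> Grz"
    if B: "vpos B \<inter> P = {}" "vneg B \<inter> Q = {}" "A \<^bold>\<rightarrow> B \<in> Grz" for B
  proof (rule ccontr, erule Grz_complete)
    fix W2 :: "fm set set" and R2 V2 y
    assume K2: "finite_poset W2 R2" and y: "y \<in> W2" and "\<not> sat W2 R2 V2 y (C \<^bold>\<rightarrow> B)"
    then have yC: "sat W2 R2 V2 y C" and yB: "\<not> sat W2 R2 V2 y B" by auto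
    \<comment> \<open>The disjunction of \<open>G\<close> stands for everything in the layer that
      fails at \<open>y\<close>. It does not follow from \<open>A\<close>, as it would then be a
      consequence recorded in \<open>C\<close> and hold at \<open>y\<close>; a countermodel supplies
      \<open>x\<close>.\<close>
    obtain G where G: "finite G" "G \<subseteq> {D \<in> ?F. \<not> sat W2 R2 V2 y D}"
      "\<And>D. D \<in> {D \<in> ?F. \<not> sat W2 R2 V2 y D} \<Longrightarrow> \<exists>E\<in>G. Grz_equiv D E"
      using finite_representatives[OF fin, of "{D \<in> ?F. \<not> sat W2 R2 V2 y D}"] by blast
    obtain Ds where Ds: "set Ds = G" using finite_list[OF G(1)] by blast
    have D: "Disj Ds \<in> ?F" using Ds G(2) by (intro Disj_bounded) auto
    have "A \<^bold>\<rightarrow> Disj Ds \<notin> Grz"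
    proof
      assume "A \<^bold>\<rightarrow> Disj Ds \<in> Grz"
      with D F(3) obtain E where E: "E \<in> F" "Grz_equiv (Disj Ds) E" by blast
      then have "sat W2 R2 V2 y E" using yC Cs by (simp add: C_def)
      then have "sat W2 R2 V2 y (Disj Ds)"
        using finite_poset.Grz_equiv_sat[OF K2 E(2) y] by blast
      then show False using Ds G(2) by auto
    qed
    then show False
    proof (rule Grz_complete)
      fix W1 :: "fm set set" and R1 V1 x
      assume K1: "finite_poset W1 R1" and x: "x \<in> W1" and "\<not> sat W1 R1 V1 x (A \<^bold>\<rightarrow> Disj Ds)"
      then have xA: "sat W1 R1 V1 x A" and xD: "\<not> sat W1 R1 V1 x (Disj Ds)" by auto
      interpret amalgam W1 R1 W2 R2 V1 V2 A P Q
        using K1 K2 by (simp add: amalgam_def)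
      have "sim (3 * nbox A + 1) x y"
        unfolding sim_def
      proof (intro ballI impI, rule ccontr)
        \<comment> \<open>Such a \<open>D\<close> would be equivalent to a disjunct of
          \<open>Ds\<close>, all of which fail at \<open>x\<close>.\<close>
        fix D assume "D \<in> ?F" "sat1 x D" "\<not> sat2 y D"
        with G(3) obtain E where E: "E \<in> G" "Grz_equiv D E" by blast
        then have "sat1 x E" using \<open>sat1 x D\<close> K1.Grz_equiv_sat[OF E(2) x] by blast
        then show False using E(1) xD Ds by auto
      qed
      then show False using amalgamation[OF x y _ xA B(1,2) yB] B(3) by blast
    qed
  qed
  ultimately have "uniform_Lyndon_interpolant Grz A P Q C"
    using C by (auto simp: uniform_Lyndon_interpolant_def bounded_fms_def)
  then show thesis using that C by (simp add: bounded_fms_def)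
qed

theorem theorem5p3:
  shows "uniform_Lyndon_interpolation Grz \<and>
    (\<forall>(A::fm) (P::nat set) (Q::nat set). finite P \<longrightarrow> finite Q \<longrightarrow>
       (\<exists>C. uniform_Lyndon_interpolant Grz A P Q C \<and> mdepth C \<le> 3 * nbox A + 3))"
proof (unfold uniform_Lyndon_interpolation_def, intro conjI allI impI)
  fix A P Q
  obtain C where "uniform_Lyndon_interpolant Grz A P Q C" "mdepth C \<le> 3 * nbox A + 1"
    by (rule uniform_Lyndon_interpolant_exists)
  then show "\<exists>C. uniform_Lyndon_interpolant Grz A P Q C"
    and "\<exists>C. uniform_Lyndon_interpolant Grz A P Q C \<and> mdepth C \<le> 3 * nbox A + 3"
    by force+
qed

end
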